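(* The class of scaling entropy sequences is a metric invariant of ergodic dynamical systems: if $T_1$ is an ergodic automorphism of a standard probability space $(X_1,\mu_1)$, $T_2$ is an ergodic automorphism of a standard probability space $(X_2,\mu_2)$, and the systems $(X_1,\mu_1,T_1)$ and $(X_2,\mu_2,T_2)$ are isomorphic (mod 0) as measure-preserving systems, then $\mathcal{H}(X_1,\mu_1,T_1)=\mathcal{H}(X_2,\mu_2,T_2)$.
   Context: A standard probability space is a Lebesgue--Rokhlin space; its measure may have atoms. An automorphism is an invertible (mod 0) measure-preserving transformation. A semimetric $\rho$ on $X$ is a nonnegative symmetric function on $X\times X$ that vanishes on the diagonal and satisfies the triangle inequality (distinct points may be at distance $0$). It is measurable if it is measurable on $(X^2,\mu^2)$ as a function of two variables. A measurable semimetric is admissible if there is a subset $X_1\subset X$ of full measure such that the semimetric space $(X_1,\rho)$ is separable. It is summable if $\int_{X\times X}\rho\,d(\mu\times\mu)<\infty$. Epsilon-entropy: for $\varepsilon>0$ let $k\in\mathbb{N}=\{1,2,\dots\}$ be the least number such that $X$ can be partitioned into disjoint measurable sets $X_0,X_1,\dots,X_k$ with $\mu(X_0)<\varepsilon$ and with the $\rho$-diameter of $X_j$ less than $\varepsilon$ for each $j=1,\dots,k$. Put $\mathbb{H}_\varepsilon(X,\mu,\rho)=\log_2 k$, and $\mathbb{H}_\varepsilon(X,\mu,\rho)=+\infty$ if no such $k$ exists. For $k\in\mathbb{Z}$ put $T^k\rho(x,y)=\rho(T^kx,T^ky)$, and for $n\ge 1$ put $T^n_{av}\rho=\frac1n\sum_{k=0}^{n-1}T^k\rho$.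 A measurable semimetric $\rho$ is (two-sided) generating for $(X,\mu,T)$ if there is a measurable set $X'\subset X$ of full measure such that for any two distinct $x,y\in X'$ there exists $k\in\mathbb{Z}$ with $T^k\rho(x,y)>0$. For an admissible semimetric $\rho$, a sequence $\{h_n\}$ of positive numbers is a scaling sequence for $\rho$ if for every $\varepsilon>0$ one has $\limsup_n \mathbb{H}_\varepsilon(X,\mu,T^n_{av}\rho)/h_n<+\infty$, and for all sufficiently small $\varepsilon>0$ one has $\liminf_n \mathbb{H}_\varepsilon(X,\mu,T^n_{av}\rho)/h_n>0$. A sequence of positive numbers is a scaling entropy sequence of $(X,\mu,T)$ if it is a scaling sequence for some (and then for any) summable admissible generating semimetric $\rho$ on $(X,\mu)$. The class of all scaling entropy sequences of $(X,\mu,T)$ is denoted $\mathcal{H}(X,\mu,T)$ (it may be empty). *)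

theory Defs
  imports "HOL-Probability.Probability"
begin

definition full_measure :: "'a measure \<Rightarrow> 'a set \<Rightarrow> bool" where
  "full_measure M A \<longleftrightarrow> A \<in> sets M \<and> space M - A \<in> null_sets M"

text \<open>
  Maps that are only defined almost everywhere are represented by total measurable functions;
  all identities between them are required almost everywhere only. On complete nonempty
  measure spaces this loses nothing: a map defined on a set of full measure can be extended by a
  constant.
\<close>

definition measure_preserving :: "'a measure \<Rightarrow> 'b measure \<Rightarrow> ('a \<Rightarrow> 'b) \<Rightarrow> bool" where
  "measure_preserving M N f \<longleftrightarrow> f \<in> M \<rightarrow>\<^sub>M N \<and> distr M N f = N"

definition inverse_mod0 :: "'a measure \<Rightarrow> 'b measure \<Rightarrow> ('a \<Rightarrow> 'b) \<Rightarrow> ('b \<Rightarrow> 'a) \<Rightarrow> bool" where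
  "inverse_mod0 M N f g \<longleftrightarrow>
     g \<in> N \<rightarrow>\<^sub>M M \<and> (AE x in M. g (f x) = x) \<and> (AE y in N. f (g y) = y)"

definition isomorphism_mod0 :: "'a measure \<Rightarrow> 'b measure \<Rightarrow> ('a \<Rightarrow> 'b) \<Rightarrow> bool" where
  "isomorphism_mod0 M N f \<longleftrightarrow> measure_preserving M N f \<and> (\<exists>g. inverse_mod0 M N f g)"

text \<open>
  The model Lebesgue--Rokhlin space: Lebesgue measure on the interval \<open>[0, a]\<close> together with
  countably many atoms, the \<open>n\<close>-th one placed at the point \<open>a + 1 + n\<close> outside the interval and
  having mass \<open>p n\<close> (which may be \<open>0\<close>).
\<close>

definition borel_model :: "real \<Rightarrow> (nat \<Rightarrow> ennreal) \<Rightarrow> real measure" where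
  "borel_model a p = measure_of UNIV (sets borel)
     (\<lambda>A. emeasure lborel (A \<inter> {0..a}) + (\<Sum>n. p n * indicator A (a + 1 + real n)))"

lemma sets_borel_model [simp]: "sets (borel_model a p) = sets borel"
  unfolding borel_model_def by (rule sets.sets_measure_of_eq[of borel, unfolded space_borel])

lemma emeasure_borel_model:
  assumes "A \<in> sets borel"
  shows "emeasure (borel_model a p) A =
    emeasure lborel (A \<inter> {0..a}) + (\<Sum>n. p n * indicator A (a + 1 + real n))"
proof -
  define D where "D = distr (density (count_space UNIV) p) borel (\<lambda>n. a + 1 + real n)"
  define R where "R = density lborel (indicator {0..a})"
  have D: "emeasure D B = (\<Sum>n. p n * indicator B (a + 1 + real n))" if "B \<in> sets borel" for B
  proof -
    have "emeasure D B = emeasure (density (count_space UNIV) p) ((\<lambda>n. a + 1 + real n) -` B)"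
      unfolding D_def using that by (subst emeasure_distr) auto
    also have "\<dots> = (\<integral>\<^sup>+ n. p n * indicator ((\<lambda>n. a + 1 + real n) -` B) n \<partial>count_space UNIV)"
      by (subst emeasure_density) auto
    also have "\<dots> = (\<Sum>n. p n * indicator B (a + 1 + real n))"
      by (subst nn_integral_count_space_nat) (simp only: indicator_vimage comp_def)
    finally show ?thesis .
  qed
  have R: "emeasure R B = emeasure lborel (B \<inter> {0..a})" if "B \<in> sets borel" for B
  proof -
    have "emeasure R B = (\<integral>\<^sup>+ x. indicator {0..a} x * indicator B x \<partial>lborel)"
      unfolding R_def using that by (subst emeasure_density) auto
    also have "\<dots> = (\<integral>\<^sup>+ x. indicator (B \<inter> {0..a}) x \<partial>lborel)"
      by (intro nn_integral_cong) (auto simp: indicator_def)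
    also have "\<dots> = emeasure lborel (B \<inter> {0..a})"
      by (rule nn_integral_indicator) (use that in auto)
    finally show ?thesis .
  qed
  let ?m = "\<lambda>A. emeasure lborel (A \<inter> {0..a}) + (\<Sum>n. p n * indicator A (a + 1 + real n))"
  have "countably_additive (sets borel) ?m"
    unfolding countably_additive_def
  proof (intro allI impI)
    fix B :: "nat \<Rightarrow> real set"
    assume B: "range B \<subseteq> sets borel" "disjoint_family B" "\<Union> (range B) \<in> sets borel"
    have Bi: "B i \<in> sets borel" for i
      using B by auto
    have "(\<Sum>i. ?m (B i)) = (\<Sum>i. emeasure R (B i) + emeasure D (B i))"
      by (simp only: R[OF Bi] D[OF Bi])
    also have "\<dots> = (\<Sum>i. emeasure R (B i)) + (\<Sum>i. emeasure D (B i))"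
      by (rule suminf_add[symmetric]) (rule summableI)+
    also have "(\<Sum>i. emeasure R (B i)) = emeasure R (\<Union>i. B i)"
      by (rule suminf_emeasure) (use B in \<open>simp_all add: R_def\<close>)
    also have "(\<Sum>i. emeasure D (B i)) = emeasure D (\<Union>i. B i)"
      by (rule suminf_emeasure) (use B in \<open>simp_all add: D_def\<close>)
    finally show "(\<Sum>i. ?m (B i)) = ?m (\<Union>i. B i)"
      by (simp only: R[OF B(3)] D[OF B(3)])
  qed
  moreover have "positive (sets borel) ?m"
    by (simp add: positive_def)
  moreover have "sigma_algebra UNIV (sets (borel :: real measure))"
    using sets.sigma_algebra_axioms[of "borel :: real measure"] by simp
  ultimately show ?thesis
    unfolding borel_model_def using assms by (intro emeasure_measure_of_sigma)
qed

definition standard_prob_space :: "'a measure \<Rightarrow> bool" where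
  "standard_prob_space M \<longleftrightarrow> prob_space M \<and> complete_measure M \<and>
     (\<exists>a p. 0 \<le> a \<and> ennreal a + (\<Sum>n. p n) = 1 \<and>
       (\<exists>f. isomorphism_mod0 M (completion (borel_model a p)) f))"

definition automorphism :: "'a measure \<Rightarrow> ('a \<Rightarrow> 'a) \<Rightarrow> bool" where
  "automorphism M T \<longleftrightarrow> isomorphism_mod0 M M T"

definition ergodic :: "'a measure \<Rightarrow> ('a \<Rightarrow> 'a) \<Rightarrow> bool" where
  "ergodic M T \<longleftrightarrow>
     (\<forall>A\<in>sets M. (AE x in M. T x \<in> A \<longleftrightarrow> x \<in> A) \<longrightarrow> emeasure M A = 0 \<or> emeasure M A = 1)"

definition isomorphic_systems ::
  "'a measure \<Rightarrow> ('a \<Rightarrow> 'a) \<Rightarrow> 'b measure \<Rightarrow> ('b \<Rightarrow> 'b) \<Rightarrow> bool" where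
  "isomorphic_systems M T N S \<longleftrightarrow>
     (\<exists>f. isomorphism_mod0 M N f \<and> (AE x in M. f (T x) = S (f x)))"

text \<open>
  Integer powers of an automorphism. The inverse is determined up to a null set only, but two
  choices of it have, for almost every point, the same iterates at that point.
\<close>

definition int_iterate :: "'a measure \<Rightarrow> ('a \<Rightarrow> 'a) \<Rightarrow> int \<Rightarrow> 'a \<Rightarrow> 'a" where
  "int_iterate M T k =
     (if 0 \<le> k then T ^^ nat k else (SOME S. inverse_mod0 M M T S) ^^ nat (- k))"

definition shifted :: "'a measure \<Rightarrow> ('a \<Rightarrow> 'a) \<Rightarrow> int \<Rightarrow> ('a \<Rightarrow> 'a \<Rightarrow> real) \<Rightarrow> 'a \<Rightarrow> 'a \<Rightarrow> real" where
  "shifted M T k \<rho> x y = \<rho> (int_iterate M T k x) (int_iterate M T k y)"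

definition averaged :: "'a measure \<Rightarrow> ('a \<Rightarrow> 'a) \<Rightarrow> nat \<Rightarrow> ('a \<Rightarrow> 'a \<Rightarrow> real) \<Rightarrow> 'a \<Rightarrow> 'a \<Rightarrow> real" where
  "averaged M T n \<rho> x y = (1 / real n) * (\<Sum>k<n. shifted M T (int k) \<rho> x y)"

definition semimetric_on :: "'a set \<Rightarrow> ('a \<Rightarrow> 'a \<Rightarrow> real) \<Rightarrow> bool" where
  "semimetric_on X \<rho> \<longleftrightarrow>
     (\<forall>x\<in>X. \<forall>y\<in>X. 0 \<le> \<rho> x y \<and> \<rho> x y = \<rho> y x) \<and>
     (\<forall>x\<in>X. \<rho> x x = 0) \<and>
     (\<forall>x\<in>X. \<forall>y\<in>X. \<forall>z\<in>X. \<rho> x z \<le> \<rho> x y + \<rho> y z)"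

text \<open>
  The square of a Lebesgue--Rokhlin space is again such a space, hence the product measure is
  completed.
\<close>

abbreviation square :: "'a measure \<Rightarrow> ('a \<times> 'a) measure" where
  "square M \<equiv> completion (M \<Otimes>\<^sub>M M)"

definition measurable_semimetric :: "'a measure \<Rightarrow> ('a \<Rightarrow> 'a \<Rightarrow> real) \<Rightarrow> bool" where
  "measurable_semimetric M \<rho> \<longleftrightarrow>
     semimetric_on (space M) \<rho> \<and> (\<lambda>(x, y). \<rho> x y) \<in> borel_measurable (square M)"

definition admissible :: "'a measure \<Rightarrow> ('a \<Rightarrow> 'a \<Rightarrow> real) \<Rightarrow> bool" where
  "admissible M \<rho> \<longleftrightarrow> measurable_semimetric M \<rho> \<and>
     (\<exists>X. full_measure M X \<and>
       (\<exists>D. countable D \<and> D \<subseteq> X \<and> (\<forall>x\<in>X. \<forall>\<epsilon>>0. \<exists>d\<in>D. \<rho> x d < \<epsilon>)))"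

definition summable_semimetric :: "'a measure \<Rightarrow> ('a \<Rightarrow> 'a \<Rightarrow> real) \<Rightarrow> bool" where
  "summable_semimetric M \<rho> \<longleftrightarrow> measurable_semimetric M \<rho> \<and>
     (\<integral>\<^sup>+ (x, y). ennreal (\<rho> x y) \<partial>square M) < \<infinity>"

definition generating :: "'a measure \<Rightarrow> ('a \<Rightarrow> 'a) \<Rightarrow> ('a \<Rightarrow> 'a \<Rightarrow> real) \<Rightarrow> bool" where
  "generating M T \<rho> \<longleftrightarrow> measurable_semimetric M \<rho> \<and>
     (\<exists>X. full_measure M X \<and>
       (\<forall>x\<in>X. \<forall>y\<in>X. x \<noteq> y \<longrightarrow> (\<exists>k::int. shifted M T k \<rho> x y > 0)))"

text \<open>The supremum is taken in \<^typ>\<open>ennreal\<close>, so that the empty set has diameter \<open>0\<close>.\<close>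

definition semimetric_diameter :: "('a \<Rightarrow> 'a \<Rightarrow> real) \<Rightarrow> 'a set \<Rightarrow> ennreal" where
  "semimetric_diameter \<rho> A = (SUP (x, y)\<in>A \<times> A. ennreal (\<rho> x y))"

text \<open>Cells of a partition are allowed to be empty.\<close>

definition entropy_partition ::
  "'a measure \<Rightarrow> ('a \<Rightarrow> 'a \<Rightarrow> real) \<Rightarrow> real \<Rightarrow> nat \<Rightarrow> (nat \<Rightarrow> 'a set) \<Rightarrow> bool" where
  "entropy_partition M \<rho> \<epsilon> k X \<longleftrightarrow>
     (\<forall>j\<le>k. X j \<in> sets M) \<and> disjoint_family_on X {..k} \<and> (\<Union>j\<le>k. X j) = space M \<and>
     emeasure M (X 0) < ennreal \<epsilon> \<and>
     (\<forall>j\<in>{1..k}. semimetric_diameter \<rho> (X j) < ennreal \<epsilon>)"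

definition epsilon_entropy :: "real \<Rightarrow> 'a measure \<Rightarrow> ('a \<Rightarrow> 'a \<Rightarrow> real) \<Rightarrow> ereal" where
  "epsilon_entropy \<epsilon> M \<rho> =
     (if \<exists>k\<ge>1. \<exists>X. entropy_partition M \<rho> \<epsilon> k X
      then ereal (log 2 (real (LEAST k. k \<ge> 1 \<and> (\<exists>X. entropy_partition M \<rho> \<epsilon> k X))))
      else \<infinity>)"

text \<open>
  Sequences are indexed by the positive integers; the value at \<open>0\<close> is unconstrained.
\<close>

definition scaling_sequence ::
  "'a measure \<Rightarrow> ('a \<Rightarrow> 'a) \<Rightarrow> ('a \<Rightarrow> 'a \<Rightarrow> real) \<Rightarrow> (nat \<Rightarrow> real) \<Rightarrow> bool" where
  "scaling_sequence M T \<rho> h \<longleftrightarrow> admissible M \<rho> \<and> (\<forall>n\<ge>1. 0 < h n) \<and>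
     (\<forall>\<epsilon>>0. limsup (\<lambda>n. epsilon_entropy \<epsilon> M (averaged M T n \<rho>) / ereal (h n)) < \<infinity>) \<and>
     (\<forall>\<^sub>F \<epsilon> in at_right 0.
        liminf (\<lambda>n. epsilon_entropy \<epsilon> M (averaged M T n \<rho>) / ereal (h n)) > 0)"

definition scaling_entropy_sequences :: "'a measure \<Rightarrow> ('a \<Rightarrow> 'a) \<Rightarrow> (nat \<Rightarrow> real) set" where
  "scaling_entropy_sequences M T =
     {h. \<exists>\<rho>. summable_semimetric M \<rho> \<and> admissible M \<rho> \<and> generating M T \<rho> \<and>
           scaling_sequence M T \<rho> h}"

end

theory Submission
  imports Defs
begin

text \<open>
  An isomorphism transports a summable admissible generating semimetric \<open>\<rho>\<close> on the first system
  to \<open>\<rho> (g x) (g y)\<close> on the second one, where \<open>g\<close> is an inverse of the isomorphism. As \<open>g\<close>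
  intertwines all integer powers of the two automorphisms outside a null set, the averages
  correspond to each other up to a null set, which the exceptional cell of an entropy partition
  absorbs. So the epsilon-entropies agree, and with them the scaling sequences.
\<close>

section \<open>Full-measure sets and measure-preserving maps\<close>

lemma full_measure_if_AE:
  assumes "AE x in M. P x"
  obtains X where "full_measure M X" "\<And>x. x \<in> X \<Longrightarrow> P x"
proof -
  \<comment> \<open>The set where \<open>P\<close> holds may fail to be measurable, so the
    complement of a null set that covers all failures is taken instead.\<close>
  obtain N where N: "\<And>x. x \<in> space M - N \<Longrightarrow> P x" "N \<in> null_sets M"
    using AE_E3[OF assms] by blast
  then have "N \<subseteq> space M"
    by (auto dest: sets.sets_into_space)
  then have "full_measure M (space M - N)"
    using N(2) by (auto simp: full_measure_def double_diff)
  with N(1) show ?thesis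
    by (rule that[rotated])
qed

lemma full_measure_iff_AE:
  "full_measure M X \<longleftrightarrow> X \<in> sets M \<and> (AE x in M. x \<in> X)"
  unfolding full_measure_def by (auto simp: AE_iff_null set_diff_eq)

lemma measure_preserving_measurable: "measure_preserving M N f \<Longrightarrow> f \<in> M \<rightarrow>\<^sub>M N"
  by (simp add: measure_preserving_def)

lemma measure_preserving_AE:
  assumes "measure_preserving M N f" "AE y in N. P y"
  shows "AE x in M. P (f x)"
  using assms AE_distrD[of f M N P] unfolding measure_preserving_def by metis

lemma measure_preserving_emeasure_vimage:
  assumes "measure_preserving M N f" "A \<in> sets N"
  shows "emeasure M (f -` A \<inter> space M) = emeasure N A"
  using assms emeasure_distr[of f M N A] by (simp add: measure_preserving_def)

text \<open>As \<open>N\<close> is the image of \<open>M\<close> under \<open>f\<close>, its image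
  under \<open>g\<close> is the image of \<open>M\<close> under \<open>g \<circ> f\<close>, which is
  the identity almost everywhere.\<close>

lemma measure_preserving_inverse:
  assumes f: "measure_preserving M N f" and g: "inverse_mod0 M N f g"
  shows "measure_preserving N M g"
proof -
  have fm [measurable]: "f \<in> M \<rightarrow>\<^sub>M N" and gm [measurable]: "g \<in> N \<rightarrow>\<^sub>M M"
    using f g by (auto simp: measure_preserving_def inverse_mod0_def)
  have "distr N M g = distr (distr M N f) M g"
    using f by (simp add: measure_preserving_def)
  also have "\<dots> = distr M M (g \<circ> f)"
    by (rule distr_distr) measurable
  also have "\<dots> = distr M M (\<lambda>x. x)"
    using g by (intro distr_cong_AE) (auto simp: inverse_mod0_def)
  finally show ?thesis
    by (simp add: measure_preserving_def)
qed

lemma inverse_mod0_commute: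
  assumes "measure_preserving M N f" "inverse_mod0 M N f g"
  shows "inverse_mod0 N M g f"
  using assms by (simp add: measure_preserving_def inverse_mod0_def)

text \<open>Semimetrics are measurable for the completed square only, so maps have to be carried
  over to completions. This works because null sets of \<open>N\<close> pull back to null sets of
  \<open>M\<close>.\<close>

lemma measure_preserving_completion:
  assumes f: "measure_preserving M N f"
  shows "measure_preserving (completion M) (completion N) f"
proof -
  have fm: "f \<in> completion M \<rightarrow>\<^sub>M N"
    using f by (simp add: measure_preserving_def measurable_completion)
  have eq: "distr (completion M) N f = N"
    using f by (simp add: measure_preserving_def distr_completion)
  have "f \<in> completion M \<rightarrow>\<^sub>M completion N"
    by (intro completion.measurable_completion2 fm) (simp add: eq)
  moreover have "distr (completion M) (completion N) f = completion N"
    using completion.completion_distr_eq[OF fm] by (simp add: eq)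
  ultimately show ?thesis
    by (simp add: measure_preserving_def)
qed

text \<open>With \<open>f' = f\<close> this is the map of squares along which functions of two
  variables are pulled back.\<close>

lemma measure_preserving_map_prod:
  assumes "measure_preserving M N f" "measure_preserving M' N' f'" "sigma_finite_measure N'"
  shows "measure_preserving (M \<Otimes>\<^sub>M M') (N \<Otimes>\<^sub>M N') (\<lambda>(x, y). (f x, f' y))"
proof -
  have [measurable]: "f \<in> M \<rightarrow>\<^sub>M N" "f' \<in> M' \<rightarrow>\<^sub>M N'"
    and eq: "distr M N f = N" "distr M' N' f' = N'"
    using assms by (simp_all add: measure_preserving_def)
  have "distr M N f \<Otimes>\<^sub>M distr M' N' f' = distr (M \<Otimes>\<^sub>M M') (N \<Otimes>\<^sub>M N') (\<lambda>(x, y). (f x, f' y))"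
    using assms(3) by (intro pair_measure_distr) (simp_all only: eq, measurable)
  then have "distr (M \<Otimes>\<^sub>M M') (N \<Otimes>\<^sub>M N') (\<lambda>(x, y). (f x, f' y)) = N \<Otimes>\<^sub>M N'"
    unfolding eq by (rule sym)
  moreover have "(\<lambda>(x, y). (f x, f' y)) \<in> M \<Otimes>\<^sub>M M' \<rightarrow>\<^sub>M N \<Otimes>\<^sub>M N'"
    by measurable
  ultimately show ?thesis
    unfolding measure_preserving_def by blast
qed

section \<open>Intertwining of iterates\<close>

lemma AE_funpow_semiconj:
  assumes S: "measure_preserving N N S" and sc: "AE x in N. g (S x) = T (g x)"
  shows "AE x in N. g ((S ^^ k) x) = (T ^^ k) (g x)"
proof (induction k)
  case (Suc k)
  \<comment> \<open>The relation for \<open>k\<close> is used at \<open>S x\<close>; its exceptional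
    set stays null there because \<open>S\<close> preserves the measure.\<close>
  from measure_preserving_AE[OF S Suc] sc show ?case
    by eventually_elim (simp add: funpow_swap1)
qed simp

text \<open>From \<open>x = S (S' x)\<close> one gets \<open>g x = T (g (S' x))\<close>, and
  applying \<open>T'\<close> cancels \<open>T\<close>.\<close>

lemma AE_inverse_semiconj:
  assumes S: "measure_preserving N N S" "inverse_mod0 N N S S'"
    and T: "inverse_mod0 M M T T'" and g: "measure_preserving N M g"
    and sc: "AE x in N. g (S x) = T (g x)"
  shows "AE x in N. g (S' x) = T' (g x)"
proof -
  have S': "measure_preserving N N S'"
    using S by (rule measure_preserving_inverse)
  have "AE x in N. g (S (S' x)) = T (g (S' x))"
    using S' sc by (rule measure_preserving_AE)
  moreover have "AE x in N. S (S' x) = x"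
    using S by (simp add: inverse_mod0_def)
  moreover have "AE z in M. T' (T z) = z"
    using T by (simp add: inverse_mod0_def)
  then have "AE x in N. T' (T (g (S' x))) = g (S' x)"
    by (intro measure_preserving_AE[OF S'] measure_preserving_AE[OF g])
  ultimately show ?thesis
    by eventually_elim metis
qed

lemma automorphism_some_inverse:
  "automorphism M T \<Longrightarrow> inverse_mod0 M M T (SOME S. inverse_mod0 M M T S)"
  unfolding automorphism_def isomorphism_mod0_def by (auto intro: someI_ex[of "inverse_mod0 M M T"])

text \<open>Negative powers use a chosen inverse, about which only its being an inverse mod 0
  matters. The integers are countable, so one null set serves all \<open>k\<close>.\<close>

lemma AE_int_iterate_semiconj:
  assumes S: "automorphism N S" and T: "automorphism M T" and g: "measure_preserving N M g"
    and sc: "AE x in N. g (S x) = T (g x)"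
  shows "AE x in N. \<forall>k. g (int_iterate N S k x) = int_iterate M T k (g x)"
proof -
  let ?S' = "SOME S'. inverse_mod0 N N S S'" and ?T' = "SOME T'. inverse_mod0 M M T T'"
  have Smp: "measure_preserving N N S"
    using S by (simp add: automorphism_def isomorphism_mod0_def)
  have "AE x in N. g (?S' x) = ?T' (g x)"
    using Smp automorphism_some_inverse[OF S] automorphism_some_inverse[OF T] g sc
    by (rule AE_inverse_semiconj)
  moreover have "measure_preserving N N ?S'"
    using Smp automorphism_some_inverse[OF S] by (rule measure_preserving_inverse)
  ultimately have "AE x in N. g (int_iterate N S k x) = int_iterate M T k (g x)" for k
    using AE_funpow_semiconj[OF Smp sc, of "nat k"] AE_funpow_semiconj[of N ?S' g ?T' "nat (- k)"]
    by (simp add: int_iterate_def)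
  then show ?thesis
    by (simp add: AE_all_countable)
qed

lemma isomorphic_systems_sym:
  assumes T: "automorphism M T" and iso: "isomorphic_systems M T N S"
  shows "isomorphic_systems N S M T"
proof -
  obtain f g where f: "measure_preserving M N f" and g: "inverse_mod0 M N f g"
    and sc: "AE x in M. f (T x) = S (f x)"
    using iso by (auto simp: isomorphic_systems_def isomorphism_mod0_def)
  have gmp: "measure_preserving N M g"
    using f g by (rule measure_preserving_inverse)
  have Tmp: "measure_preserving M M T"
    using T by (simp add: automorphism_def isomorphism_mod0_def)
  have "AE z in M. g (f z) = z"
    using g by (simp add: inverse_mod0_def)
  then have "AE y in N. g (f (T (g y))) = T (g y)"
    by (intro measure_preserving_AE[OF gmp] measure_preserving_AE[OF Tmp])
  moreover have "AE y in N. f (T (g y)) = S (f (g y))"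
    using gmp sc by (rule measure_preserving_AE)
  moreover have "AE y in N. f (g y) = y"
    using g by (simp add: inverse_mod0_def)
  \<comment> \<open>The chain is
    \<open>g (S y) = g (S (f (g y))) = g (f (T (g y))) = T (g y)\<close>.\<close>
  ultimately have "AE y in N. g (S y) = T (g y)"
    by eventually_elim metis
  then show ?thesis
    using gmp inverse_mod0_commute[OF f g]
    by (auto simp: isomorphic_systems_def isomorphism_mod0_def)
qed

text \<open>The same \<open>X\<close> works for every \<open>n\<close>, since all iterates are
  intertwined on it at once. Diameters are suprema over all pairs of points, so equality on the
  whole of \<open>X \<times> X\<close> is wanted, not just almost everywhere in the square.\<close>

lemma AE_averaged_pullback:
  assumes "automorphism N S" "automorphism M T" "measure_preserving N M g"
    and "AE x in N. g (S x) = T (g x)"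
  obtains X where "full_measure N X"
    and "\<And>x y n. x \<in> X \<Longrightarrow> y \<in> X \<Longrightarrow>
      averaged N S n (\<lambda>x y. \<rho> (g x) (g y)) x y = averaged M T n \<rho> (g x) (g y)"
proof -
  obtain X where X: "full_measure N X"
    "\<And>x. x \<in> X \<Longrightarrow> \<forall>k. g (int_iterate N S k x) = int_iterate M T k (g x)"
    using full_measure_if_AE[OF AE_int_iterate_semiconj[OF assms]] by blast
  then show ?thesis
    by (intro that[of X]) (auto simp: averaged_def shifted_def)
qed

section \<open>Transport of the properties of a semimetric\<close>

lemma measurable_semimetric_pullback:
  assumes \<rho>: "measurable_semimetric M \<rho>" and g: "measure_preserving N M g"
    and M: "sigma_finite_measure M"
  shows "measurable_semimetric N (\<lambda>x y. \<rho> (g x) (g y))"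
proof -
  have gx: "g x \<in> space M" if "x \<in> space N" for x
    using that measurable_space[OF measure_preserving_measurable[OF g]] by blast
  have "(\<lambda>(x, y). (g x, g y)) \<in> square N \<rightarrow>\<^sub>M square M"
    using g g M
    by (intro measure_preserving_measurable measure_preserving_completion measure_preserving_map_prod)
  moreover have "(\<lambda>(x, y). \<rho> x y) \<in> borel_measurable (square M)"
    using \<rho> by (simp add: measurable_semimetric_def)
  ultimately have "(\<lambda>p. (\<lambda>(x, y). \<rho> x y) ((\<lambda>(x, y). (g x, g y)) p)) \<in> borel_measurable (square N)"
    by (rule measurable_compose)
  moreover have "(\<lambda>p. (\<lambda>(x, y). \<rho> x y) ((\<lambda>(x, y). (g x, g y)) p)) = (\<lambda>(x, y). \<rho> (g x) (g y))"
    by auto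
  ultimately show ?thesis
    using \<rho> gx unfolding measurable_semimetric_def semimetric_on_def by auto
qed

text \<open>Change of variables: \<open>(x, y) \<mapsto> (g x, g y)\<close> carries the completed
  square of \<open>N\<close> to that of \<open>M\<close>, so the two integrals are equal.\<close>

lemma summable_semimetric_pullback:
  assumes \<rho>: "summable_semimetric M \<rho>" and g: "measure_preserving N M g"
    and M: "sigma_finite_measure M"
  shows "summable_semimetric N (\<lambda>x y. \<rho> (g x) (g y))"
proof -
  let ?G = "\<lambda>(x, y). (g x, g y)"
  have ms: "measurable_semimetric M \<rho>"
    using \<rho> by (simp add: summable_semimetric_def)
  have G: "measure_preserving (square N) (square M) ?G"
    using g g M by (intro measure_preserving_completion measure_preserving_map_prod)
  then have eq: "distr (square N) (square M) ?G = square M"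
    by (simp add: measure_preserving_def)
  have [measurable]: "(\<lambda>(x, y). \<rho> x y) \<in> borel_measurable (square M)"
    using ms by (simp add: measurable_semimetric_def)
  have "(\<lambda>p. ennreal ((\<lambda>(x, y). \<rho> x y) p)) \<in> borel_measurable (square M)"
    by measurable
  then have "(\<lambda>(x, y). ennreal (\<rho> x y)) \<in> borel_measurable (distr (square N) (square M) ?G)"
    by (simp add: case_prod_unfold)
  from nn_integral_distr[OF measure_preserving_measurable[OF G] this]
  have "(\<integral>\<^sup>+ (x, y). ennreal (\<rho> x y) \<partial>square M) = (\<integral>\<^sup>+ (x, y). ennreal (\<rho> (g x) (g y)) \<partial>square N)"
    unfolding eq by (simp add: case_prod_unfold)
  then show ?thesis
    using \<rho> measurable_semimetric_pullback[OF ms g M] unfolding summable_semimetric_def by metis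
qed

text \<open>The centres need not lie in the image of \<open>g\<close>, so they are replaced by nearby points.\<close>

lemma separable_pullback:
  fixes \<rho> :: "'a \<Rightarrow> 'a \<Rightarrow> real"
  assumes \<rho>: "semimetric_on Y \<rho>" and g: "g ` X \<subseteq> Y"
    and D: "countable D" "D \<subseteq> Y" "\<And>y \<epsilon>. y \<in> Y \<Longrightarrow> \<epsilon> > 0 \<Longrightarrow> \<exists>d\<in>D. \<rho> y d < \<epsilon>"
  shows "\<exists>E. countable E \<and> E \<subseteq> X \<and> (\<forall>x\<in>X. \<forall>\<epsilon>>0. \<exists>e\<in>E. \<rho> (g x) (g e) < \<epsilon>)"
proof -
  define P where "P = (\<lambda>(d, n) x. x \<in> X \<and> \<rho> (g x) d < 1 / real (Suc n))"
  define I where "I = {i \<in> D \<times> UNIV. \<exists>x. P i x}"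
  define E where "E = (\<lambda>i. SOME x. P i x) ` I"
  have P: "P i (SOME x. P i x)" if "i \<in> I" for i
    using that by (auto simp: I_def intro: someI)
  have "countable E"
    unfolding E_def I_def using D(1) by (intro countable_image countable_Collect) auto
  moreover have "E \<subseteq> X"
    using P by (fastforce simp: E_def P_def)
  moreover have "\<exists>e\<in>E. \<rho> (g x) (g e) < \<epsilon>" if x: "x \<in> X" and "\<epsilon> > 0" for x \<epsilon>
  proof -
    \<comment> \<open>Both \<open>g x\<close> and the image of the selected point will be within
      \<open>1 / (n + 1)\<close> of \<open>d\<close>, hence the half.\<close>
    obtain n where n: "1 / real (Suc n) < \<epsilon> / 2"
      using \<open>\<epsilon> > 0\<close> nat_approx_posE[of "\<epsilon> / 2"] by auto
    obtain d where d: "d \<in> D" "\<rho> (g x) d < 1 / real (Suc n)"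
      using D(3)[of "g x" "1 / real (Suc n)"] g x by auto
    have i: "(d, n) \<in> I"
      using d x by (auto simp: I_def P_def)
    define e where "e = (SOME x. P (d, n) x)"
    have "P (d, n) e"
      unfolding e_def by (rule P[OF i])
    moreover have "e \<in> E"
      unfolding E_def e_def using i by (rule imageI)
    ultimately have e: "e \<in> E" "e \<in> X" "\<rho> (g e) d < 1 / real (Suc n)"
      by (simp_all add: P_def)
    have "\<rho> (g x) (g e) \<le> \<rho> (g x) d + \<rho> d (g e)" "\<rho> d (g e) = \<rho> (g e) d"
      using \<rho> d(1) D(2) g x e(2) unfolding semimetric_on_def by blast+
    with d e n have "\<rho> (g x) (g e) < \<epsilon>"
      by linarith
    with e(1) show ?thesis
      by blast
  qed
  ultimately show ?thesis
    by blast
qed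

lemma admissible_pullback:
  assumes \<rho>: "admissible M \<rho>" and g: "measure_preserving N M g" and M: "sigma_finite_measure M"
  shows "admissible N (\<lambda>x y. \<rho> (g x) (g y))"
proof -
  obtain Y D where Y: "full_measure M Y"
    and D: "countable D" "D \<subseteq> Y" "\<And>y \<epsilon>. y \<in> Y \<Longrightarrow> \<epsilon> > 0 \<Longrightarrow> \<exists>d\<in>D. \<rho> y d < \<epsilon>"
    using \<rho> unfolding admissible_def by blast
  have ms: "measurable_semimetric M \<rho>"
    using \<rho> by (simp add: admissible_def)
  \<comment> \<open>The selection of centres requires every point of \<open>X\<close>, not just
    almost every one, to be mapped into \<open>Y\<close>.\<close>
  define X where "X = g -` Y \<inter> space N"
  have "AE y in M. y \<in> Y"
    using Y by (simp add: full_measure_iff_AE)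
  with g have "AE x in N. g x \<in> Y"
    by (rule measure_preserving_AE)
  moreover have "X \<in> sets N"
    unfolding X_def using Y measure_preserving_measurable[OF g]
    by (auto simp: full_measure_def intro: measurable_sets)
  ultimately have "full_measure N X"
    unfolding full_measure_iff_AE X_def by auto
  moreover have "Y \<subseteq> space M"
    using Y by (auto simp: full_measure_def dest: sets.sets_into_space)
  then have "semimetric_on Y \<rho>"
    using ms unfolding measurable_semimetric_def semimetric_on_def by blast
  then have "\<exists>E. countable E \<and> E \<subseteq> X \<and> (\<forall>x\<in>X. \<forall>\<epsilon>>0. \<exists>e\<in>E. \<rho> (g x) (g e) < \<epsilon>)"
    by (rule separable_pullback[OF _ _ D]) (auto simp: X_def)
  ultimately show ?thesis
    using measurable_semimetric_pullback[OF ms g M]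
    unfolding admissible_def by fast
qed

lemma generating_pullback:
  assumes \<rho>: "generating M T \<rho>" and M: "sigma_finite_measure M"
    and S: "automorphism N S" and T: "automorphism M T"
    and g: "measure_preserving N M g" "inverse_mod0 N M g f"
    and sc: "AE x in N. g (S x) = T (g x)"
  shows "generating N S (\<lambda>x y. \<rho> (g x) (g y))"
proof -
  obtain Y where Y: "full_measure M Y"
    and pos: "\<And>x y. x \<in> Y \<Longrightarrow> y \<in> Y \<Longrightarrow> x \<noteq> y \<Longrightarrow> \<exists>k. shifted M T k \<rho> x y > 0"
    using \<rho> unfolding generating_def by blast
  have "AE y in M. y \<in> Y"
    using Y by (simp add: full_measure_iff_AE)
  with g(1) have "AE x in N. g x \<in> Y"
    by (rule measure_preserving_AE)
  moreover have "AE x in N. f (g x) = x"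
    using g by (simp add: inverse_mod0_def)
  ultimately have "AE x in N. g x \<in> Y \<and> f (g x) = x \<and>
      (\<forall>k. g (int_iterate N S k x) = int_iterate M T k (g x))"
    using AE_int_iterate_semiconj[OF S T g(1) sc] by eventually_elim blast
  then obtain X where X: "full_measure N X"
    and X': "\<And>x. x \<in> X \<Longrightarrow> g x \<in> Y \<and> f (g x) = x \<and>
      (\<forall>k. g (int_iterate N S k x) = int_iterate M T k (g x))"
    by (elim full_measure_if_AE) blast
  have "\<exists>k. shifted N S k (\<lambda>x y. \<rho> (g x) (g y)) x y > 0"
    if xy: "x \<in> X" "y \<in> X" "x \<noteq> y" for x y
  proof -
    \<comment> \<open>On \<open>X\<close> the map \<open>g\<close> has the left inverse
      \<open>f\<close>, so it is injective there.\<close>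
    have "g x \<noteq> g y"
      using X' xy by metis
    then obtain k where "shifted M T k \<rho> (g x) (g y) > 0"
      using pos X' xy by blast
    then show ?thesis
      using X' xy by (auto simp: shifted_def)
  qed
  moreover have "measurable_semimetric N (\<lambda>x y. \<rho> (g x) (g y))"
    by (rule measurable_semimetric_pullback[OF _ g(1) M, of \<rho>]) (use \<rho> in \<open>simp add: generating_def\<close>)
  ultimately show ?thesis
    using X unfolding generating_def by (intro conjI exI[of _ X]) simp_all
qed

section \<open>Invariance of the epsilon-entropy\<close>

lemma entropy_partition_pullback:
  assumes g: "measure_preserving N M g" and X: "full_measure N X"
    and eq: "\<And>x y. x \<in> X \<Longrightarrow> y \<in> X \<Longrightarrow> r' x y = r (g x) (g y)"
    and C: "entropy_partition M r \<epsilon> k C"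
  shows "\<exists>C'. entropy_partition N r' \<epsilon> k C'"
proof -
  have gm [measurable]: "g \<in> N \<rightarrow>\<^sub>M M"
    using g by (rule measure_preserving_measurable)
  have Xs [measurable]: "X \<in> sets N" and Xn: "space N - X \<in> null_sets N"
    using X by (auto simp: full_measure_def)
  have XN: "X \<subseteq> space N"
    using Xs by (rule sets.sets_into_space)
  have Cs: "\<And>j. j \<le> k \<Longrightarrow> C j \<in> sets M" and disj: "disjoint_family_on C {..k}"
    and un: "(\<Union>j\<le>k. C j) = space M" and C0: "emeasure M (C 0) < ennreal \<epsilon>"
    and diam: "\<And>j. j \<in> {1..k} \<Longrightarrow> semimetric_diameter r (C j) < ennreal \<epsilon>"
    using C by (auto simp: entropy_partition_def)
  \<comment> \<open>Preimages of cells keep their index. The null complement of \<open>X\<close>,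
    where \<open>r'\<close> is uncontrolled, joins cell \<open>0\<close>, the only one without a
    diameter bound, so \<open>k\<close> does not change.\<close>
  define C' where "C' = (\<lambda>j. (g -` C j \<inter> X) \<union> (if j = 0 then space N - X else {}))"
  have pre: "g -` C j \<inter> X \<in> sets N" if "j \<le> k" for j
  proof -
    have "g -` C j \<inter> X = (g -` C j \<inter> space N) \<inter> X"
      using XN by auto
    with measurable_sets[OF gm Cs[OF that]] show ?thesis
      by simp
  qed
  have "C' j \<in> sets N" if "j \<le> k" for j
    using pre[OF that] by (auto simp: C'_def)
  moreover have "disjoint_family_on C' {..k}"
    using disj XN unfolding disjoint_family_on_def C'_def by (fastforce split: if_splits)
  moreover have "(\<Union>j\<le>k. C' j) = space N"
  proof
    show "(\<Union>j\<le>k. C' j) \<subseteq> space N"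
      using XN by (auto simp: C'_def split: if_splits)
    show "space N \<subseteq> (\<Union>j\<le>k. C' j)"
    proof
      fix x assume x: "x \<in> space N"
      then have "g x \<in> (\<Union>j\<le>k. C j)"
        using un measurable_space[OF gm] by simp
      then obtain j where "j \<le> k" "g x \<in> C j"
        by blast
      with x have "x \<in> C' (if x \<in> X then j else 0)"
        by (auto simp: C'_def)
      with \<open>j \<le> k\<close> show "x \<in> (\<Union>j\<le>k. C' j)"
        by (cases "x \<in> X") auto
    qed
  qed
  moreover have "emeasure N (C' 0) < ennreal \<epsilon>"
  proof -
    have "emeasure N (C' 0) = emeasure N (g -` C 0 \<inter> X)"
      using emeasure_Un_null_set[OF pre[of 0] Xn] by (simp add: C'_def)
    also have "\<dots> \<le> emeasure N (g -` C 0 \<inter> space N)"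
      using XN measurable_sets[OF gm Cs[of 0]] by (intro emeasure_mono) auto
    also have "\<dots> = emeasure M (C 0)"
      using Cs[of 0] by (simp add: measure_preserving_emeasure_vimage[OF g])
    finally show ?thesis
      using C0 by simp
  qed
  moreover have "semimetric_diameter r' (C' j) < ennreal \<epsilon>" if "j \<in> {1..k}" for j
  proof -
    \<comment> \<open>As \<open>j \<ge> 1\<close>, the cell lies inside \<open>X\<close>, where
      \<open>r'\<close> is the pullback of \<open>r\<close>. The image of the cell may miss points
      of \<open>C j\<close>, so the diameters are compared by an inequality only.\<close>
    have "ennreal (r' x y) \<le> semimetric_diameter r (C j)" if "x \<in> C' j" "y \<in> C' j" for x y
    proof -
      have "x \<in> X" "y \<in> X" "(g x, g y) \<in> C j \<times> C j"
        using that \<open>j \<in> {1..k}\<close> by (auto simp: C'_def)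
      then show ?thesis
        unfolding semimetric_diameter_def by (intro SUP_upper2[of "(g x, g y)"]) (auto simp: eq)
    qed
    then have "semimetric_diameter r' (C' j) \<le> semimetric_diameter r (C j)"
      unfolding semimetric_diameter_def[of r'] by (intro SUP_least) auto
    with diam[OF that] show ?thesis
      by (rule order.strict_trans1[rotated])
  qed
  ultimately show ?thesis
    unfolding entropy_partition_def by blast
qed

text \<open>Partitions are pulled back along \<open>g\<close> and also along \<open>f\<close>: on a
  full-measure set \<open>Y\<close>, \<open>f\<close> lands in \<open>X\<close> and
  \<open>g (f x) = x\<close>, so there \<open>r\<close> is in turn the pullback of
  \<open>r'\<close>. The possible \<open>k\<close> are thus the same on both sides, which covers the
  infinite value as well.\<close>

lemma epsilon_entropy_pullback:
  assumes g: "measure_preserving N M g" "inverse_mod0 N M g f" and X: "full_measure N X"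
    and eq: "\<And>x y. x \<in> X \<Longrightarrow> y \<in> X \<Longrightarrow> r' x y = r (g x) (g y)"
  shows "epsilon_entropy \<epsilon> N r' = epsilon_entropy \<epsilon> M r"
proof -
  have f: "measure_preserving M N f"
    using g by (rule measure_preserving_inverse)
  have "AE y in N. y \<in> X"
    using X by (simp add: full_measure_iff_AE)
  with f have "AE x in M. f x \<in> X"
    by (rule measure_preserving_AE)
  moreover have "AE x in M. g (f x) = x"
    using g by (simp add: inverse_mod0_def)
  ultimately have "AE x in M. f x \<in> X \<and> g (f x) = x"
    by eventually_elim blast
  then obtain Y where Y: "full_measure M Y" "\<And>x. x \<in> Y \<Longrightarrow> f x \<in> X \<and> g (f x) = x"
    by (elim full_measure_if_AE) blast
  have "(\<exists>C. entropy_partition N r' \<epsilon> k C) \<longleftrightarrow> (\<exists>C. entropy_partition M r \<epsilon> k C)" for k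
  proof
    assume "\<exists>C. entropy_partition N r' \<epsilon> k C"
    moreover have "r x y = r' (f x) (f y)" if "x \<in> Y" "y \<in> Y" for x y
      using that Y(2) eq by simp
    ultimately show "\<exists>C. entropy_partition M r \<epsilon> k C"
      using entropy_partition_pullback[where r = r' and r' = r, OF f Y(1)] by blast
  next
    assume "\<exists>C. entropy_partition M r \<epsilon> k C"
    with entropy_partition_pullback[where r = r and r' = r', OF g(1) X eq]
    show "\<exists>C. entropy_partition N r' \<epsilon> k C"
      by blast
  qed
  then show ?thesis
    by (simp add: epsilon_entropy_def)
qed

section \<open>Invariance of the class of scaling entropy sequences\<close>

lemma scaling_entropy_sequences_subset:
  assumes M: "sigma_finite_measure M" and S: "automorphism N S" and T: "automorphism M T"
    and iso: "isomorphic_systems N S M T"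
  shows "scaling_entropy_sequences M T \<subseteq> scaling_entropy_sequences N S"
proof
  fix h assume "h \<in> scaling_entropy_sequences M T"
  then obtain \<rho> where \<rho>: "summable_semimetric M \<rho>" "admissible M \<rho>" "generating M T \<rho>"
    and h: "scaling_sequence M T \<rho> h"
    by (auto simp: scaling_entropy_sequences_def)
  obtain f g where g: "measure_preserving N M g" "inverse_mod0 N M g f"
    and sc: "AE x in N. g (S x) = T (g x)"
    using iso by (auto simp: isomorphic_systems_def isomorphism_mod0_def)
  let ?\<rho>' = "\<lambda>x y. \<rho> (g x) (g y)"
  obtain X where "full_measure N X"
    "\<And>x y n. x \<in> X \<Longrightarrow> y \<in> X \<Longrightarrow> averaged N S n ?\<rho>' x y = averaged M T n \<rho> (g x) (g y)"
    by (rule AE_averaged_pullback[OF S T g(1) sc, of \<rho>]) blast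
  \<comment> \<open>The entropies are equal for every \<open>\<epsilon>\<close> and
    \<open>n\<close>, so the quotients by \<open>h n\<close> coincide term by term and both limit
    conditions carry over.\<close>
  then have "epsilon_entropy \<epsilon> N (averaged N S n ?\<rho>') = epsilon_entropy \<epsilon> M (averaged M T n \<rho>)" for \<epsilon> n
    by (intro epsilon_entropy_pullback[OF g]) auto
  then have "scaling_sequence N S ?\<rho>' h"
    using h admissible_pullback[OF \<rho>(2) g(1) M] by (simp add: scaling_sequence_def)
  then show "h \<in> scaling_entropy_sequences N S"
    using summable_semimetric_pullback[OF \<rho>(1) g(1) M] admissible_pullback[OF \<rho>(2) g(1) M]
      generating_pullback[OF \<rho>(3) M S T g sc]
    unfolding scaling_entropy_sequences_def by blast
qed

theorem corollary1:
  fixes M1 :: "'a measure" and M2 :: "'b measure"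
    and T1 :: "'a \<Rightarrow> 'a" and T2 :: "'b \<Rightarrow> 'b"
  assumes "standard_prob_space M1" and "automorphism M1 T1" and "ergodic M1 T1"
    and "standard_prob_space M2" and "automorphism M2 T2" and "ergodic M2 T2"
    and "isomorphic_systems M1 T1 M2 T2"
  shows "scaling_entropy_sequences M1 T1 = scaling_entropy_sequences M2 T2"
proof -
  have "sigma_finite_measure M1" "sigma_finite_measure M2"
    using assms(1,4)
    by (simp_all add: standard_prob_space_def prob_space_imp_sigma_finite)
  \<comment> \<open>Semimetrics are pulled back to the source of an isomorphism: the given one puts
    the class of the second system inside that of the first, and its inverse gives the other
    inclusion.\<close>
  then show ?thesis
    using assms(2,5,7) isomorphic_systems_sym[OF assms(2,7)]
    by (intro equalityI scaling_entropy_sequences_subset)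
qed

end
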